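(* Let $p$ be an odd prime, $m\in\mathbb{Z}_p$ with $m\not\equiv0\pmod p$, and $t=1-\frac{32}{m}$. Then $$\sum_{n=0}^{p-1}\frac{G_n}{m^n}\equiv\Big(\frac{m(m-16)}{p}\Big)\sum_{k=0}^{\frac{p-1}{2}}\frac{\binom{2k}{k}^2}{m^k}\equiv-\Big(\frac{-3(1+t)}{p}\Big)\sum_{x=0}^{p-1}\Big(\frac{x^3-3(t^2+3)x+2t(t^2-9)}{p}\Big)\pmod p.$$
   Context: $\mathbb{Z}_p$ denotes the set of rationals whose denominator is not divisible by $p$; congruences are in this ring. For $a\in\mathbb{Z}_p$, $\big(\frac{a}{p}\big)$ is the Legendre symbol of the residue of $a$ modulo $p$ (equal to $0$ if $a\equiv0\pmod p$). For $n\ge0$, $G_n=\sum_{k=0}^n \binom{2k}{k}^2\binom{2n-2k}{n-k}4^{n-k}$. *)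

theory Defs
  imports "HOL-Number_Theory.Number_Theory"
begin

definition p_integral :: "nat \<Rightarrow> rat set" where
  "p_integral p = {a. \<not> int p dvd snd (quotient_of a)}"

definition p_cong :: "nat \<Rightarrow> rat \<Rightarrow> rat \<Rightarrow> bool" where
  "p_cong p a b \<longleftrightarrow>
     a \<in> p_integral p \<and> b \<in> p_integral p \<and> (\<exists>c\<in>p_integral p. a - b = of_nat p * c)"

(* Unique for prime p and a in p_integral p; unspecified for other a. *)
definition p_residue :: "nat \<Rightarrow> rat \<Rightarrow> int" where
  "p_residue p a = (THE r. 0 \<le> r \<and> r < int p \<and> p_cong p a (of_int r))"

definition p_legendre :: "rat \<Rightarrow> nat \<Rightarrow> int" where
  "p_legendre a p = Legendre (p_residue p a) (int p)"

definition G_num :: "nat \<Rightarrow> nat" where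
  "G_num n = (\<Sum>k=0..n. (2*k choose k)^2 * ((2*n - 2*k) choose (n - k)) * 4^(n - k))"

end

theory Submission
  imports Defs
begin

text \<open>
  Put \<open>n = (p - 1) / 2\<close>, \<open>s = 16 / m\<close>, so \<open>t = 1 - 2 s\<close>, and let \<open>H = \<Sum>k\<le>n. binom(n,k)^2 s^k\<close>. Modulo \<open>p\<close>
  one has \<open>binom(2k,k) = (-4)^k binom(n,k)\<close>, which vanishes for \<open>n < k < p\<close>. Hence the
  convolution defining \<open>G\<close> sums to \<open>H (1 - s)^n\<close>, and Euler's criterion identifies \<open>(1 - s)^n\<close>
  with the Legendre symbol of \<open>m (m - 16)\<close>. By Euler's criterion the character sum is the sum of the \<open>n\<close>-th
  powers of the cubic. The cubic has roots \<open>-2 t\<close>, \<open>t + 3\<close>, \<open>t - 3\<close>; for \<open>p > 3\<close> the substitution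
  \<open>x = 6 z - 2 - 2 s\<close> turns it into \<open>216 z (z - 1) (z - s)\<close>, and since only the monomial
  \<open>z^(p-1)\<close> survives summation over \<open>z\<close>, the sum is \<open>-(-216)^n H\<close>. For \<open>p = 3\<close> both sides of
  the second congruence vanish.
\<close>

section \<open>Central binomial coefficients modulo \<open>p\<close>\<close>

text \<open>The two Pascal summands of binom(2k+2,k+1) agree by symmetry, and absorption turns one
  of them into binom(2k,k). This is the ratio recurrence that is matched with that of
  binom(n,k).\<close>

lemma Suc_times_central_binomial:
  "Suc k * ((2 * Suc k) choose Suc k) = 2 * (2 * k + 1) * ((2 * k) choose k)"
proof -
  have "(Suc (2 * k)) choose Suc k = (Suc (2 * k)) choose k"
    using binomial_symmetric[of "Suc k" "Suc (2 * k)"] by simp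
  then have "(2 * Suc k) choose Suc k = 2 * ((Suc (2 * k)) choose Suc k)"
    by simp
  moreover have "Suc k * ((Suc (2 * k)) choose Suc k) = Suc (2 * k) * ((2 * k) choose k)"
    using binomial_absorption[of k "Suc (2 * k)"] by (simp del: binomial_Suc_Suc)
  ultimately show ?thesis by (metis Suc_eq_plus1 mult.assoc mult.left_commute)
qed

text \<open>Over the integers the recurrence also covers \<open>k > n\<close>, where both binomials
  vanish; this matters because \<open>k\<close> later runs up to \<open>p - 1\<close>.\<close>

lemma Suc_times_binomial_Suc_int:
  "int (Suc k) * int (n choose Suc k) = (int n - int k) * int (n choose k)"
proof (cases "k \<le> n")
  case True
  have "Suc k * (n choose Suc k) = (n - k) * (n choose k)"
    by (simp only: binomial_absorption binomial_absorb_comp)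
  then have "int (Suc k) * int (n choose Suc k) = int (n - k) * int (n choose k)"
    by (metis of_nat_mult)
  then show ?thesis using True by (simp add: of_nat_diff)
qed (simp add: binomial_eq_0)

lemma coprime_int_prime_of_less:
  fixes p k :: nat
  assumes "prime p" "0 < k" "k < p"
  shows "coprime (int k) (int p)"
proof -
  have "\<not> p dvd k" using assms by (auto dest: dvd_imp_le)
  then show ?thesis
    using assms(1) prime_imp_coprime coprime_commute coprime_int_iff by blast
qed

text \<open>Modulo \<open>p = 2 n + 1\<close> one has \<open>n = -1/2\<close>, so this is
  \<open>binom(2k,k) = (-4)^k binom(-1/2,k)\<close>.\<close>
lemma central_binomial_cong:
  fixes p n k :: nat
  assumes "prime p" and p: "p = 2 * n + 1" and "k < p"
  shows "[int ((2 * k) choose k) = (-4) ^ k * int (n choose k)] (mod int p)"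
  using \<open>k < p\<close>
proof (induction k)
  case (Suc k)
  then have IH: "[int ((2 * k) choose k) = (-4) ^ k * int (n choose k)] (mod int p)" by simp
  have cop: "coprime (int (Suc k)) (int p)"
    using coprime_int_prime_of_less[OF assms(1), of "Suc k"] Suc.prems by simp
  have "int (Suc k) * int ((2 * Suc k) choose Suc k)
      = 2 * (2 * int k + 1) * int ((2 * k) choose k)"
    using arg_cong[OF Suc_times_central_binomial[of k], of int]
    by (simp only: of_nat_mult of_nat_add of_nat_numeral of_nat_1)
  \<comment> \<open>The two ratio recurrences agree modulo \<open>p\<close>: their factors differ by
    \<open>4 * n + 2 = 2 * p\<close>.\<close>
  moreover have "[2 * (2 * int k + 1) * int ((2 * k) choose k)
      = (-4) * (int n - int k) * ((-4) ^ k * int (n choose k))] (mod int p)"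
  proof (rule cong_mult[OF _ IH])
    have "2 * (2 * int k + 1) - (-4) * (int n - int k) = 2 * int p"
      using p by simp
    then show "[2 * (2 * int k + 1) = (-4) * (int n - int k)] (mod int p)"
      by (metis cong_iff_dvd_diff dvd_triv_right)
  qed
  moreover have "(-4) * (int n - int k) * ((-4) ^ k * int (n choose k))
     = int (Suc k) * ((-4) ^ Suc k * int (n choose Suc k))"
    by (simp only: power_Suc mult.assoc mult.left_commute[of "int (Suc k)"]
        mult.left_commute[of "int n - int k"] Suc_times_binomial_Suc_int)
  ultimately have "[int (Suc k) * int ((2 * Suc k) choose Suc k)
      = int (Suc k) * ((-4) ^ Suc k * int (n choose Suc k))] (mod int p)"
    by metis
  then show ?case using cong_mult_lcancel[OF cop] by blast
qed simp

section \<open>Power sums over a complete residue system\<close>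

text \<open>Telescoping (x+1)^(j+1) - x^(j+1) over the residues gives p^(j+1), while the binomial
  theorem writes the same sum as j+1 times the j-th power sum plus multiples of lower ones. By
  induction \<open>p\<close> divides all other terms, and j+1 < p can be cancelled.\<close>

lemma prime_dvd_sum_powers:
  fixes p j :: nat
  assumes "prime p" "j < p - 1"
  shows "int p dvd (\<Sum>x<p. int x ^ j)"
  using assms(2)
proof (induction j rule: less_induct)
  case (less j)
  let ?S = "\<lambda>i. \<Sum>x<p. int x ^ i"
  have step: "(int x + 1) ^ Suc j - int x ^ Suc j = (\<Sum>i\<le>j. int (Suc j choose i) * int x ^ i)" for x
    using binomial_ring[of "int x" 1 "Suc j"] by (simp del: binomial_Suc_Suc power_Suc)
  have "int p ^ Suc j = (\<Sum>x<p. (int x + 1) ^ Suc j - int x ^ Suc j)"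
    using sum_lessThan_telescope[of "\<lambda>x. int x ^ Suc j" p] by (simp add: add.commute)
  also have "\<dots> = (\<Sum>i\<le>j. int (Suc j choose i) * ?S i)"
    by (simp only: step sum.swap[of _ "{..<p}"] sum_distrib_left)
  also have "\<dots> = (\<Sum>i<j. int (Suc j choose i) * ?S i) + int (Suc j) * ?S j"
    by (simp add: lessThan_Suc_atMost[symmetric] del: binomial_Suc_Suc)
  finally have "int (Suc j) * ?S j = int p ^ Suc j - (\<Sum>i<j. int (Suc j choose i) * ?S i)"
    by simp
  also have "int p dvd \<dots>"
  proof (rule dvd_diff)
    show "int p dvd (\<Sum>i<j. int (Suc j choose i) * ?S i)"
      using less by (intro dvd_sum[of "{..<j}"] dvd_mult less.IH) auto
  qed simp
  finally have "int p dvd int (Suc j) * ?S j" .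
  moreover have "coprime (int p) (int (Suc j))"
    using coprime_int_prime_of_less[OF assms(1), of "Suc j"] less.prems
    by (simp add: coprime_commute)
  ultimately show ?case using coprime_dvd_mult_right_iff by blast
qed

text \<open>Fermat's theorem lowers exponents above \<open>p - 1\<close> into the range already
  treated, and at \<open>p - 1\<close> itself it leaves \<open>p - 1\<close> ones. The bound is
  chosen to cover degree 3n, the degree of the n-th power of a cubic with
  \<open>p = 2 * n + 1\<close>.\<close>

lemma sum_powers_cong:
  fixes p j :: nat
  assumes "prime p" "j < 2 * (p - 1)"
  shows "[(\<Sum>x<p. int x ^ j) = (if j = p - 1 then -1 else 0)] (mod int p)"
proof -
  have p1: "p > 1" using assms(1) prime_gt_1_nat by blast
  have fermat: "[int x ^ (p - 1) = 1] (mod int p)" if "0 < x" "x < p" for x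
  proof -
    have "\<not> p dvd x" using that by (auto dest: dvd_imp_le)
    then show ?thesis
      using fermat_theorem[OF assms(1)] by (metis cong_int_iff of_nat_1 of_nat_power)
  qed
  \<comment> \<open>The case \<open>x = 0\<close>, \<open>i = 0\<close> must be excluded: there the
    left side is 0 but \<open>0 ^ 0 = 1\<close>.\<close>
  have shift: "[int x ^ (p - 1 + i) = int x ^ i] (mod int p)" if "0 < x \<or> 0 < i" "x < p" for x i
  proof (cases "x = 0")
    case False
    then show ?thesis
      using cong_mult[OF fermat cong_refl, of x "int x ^ i"] that
      by (simp only: power_add mult_1_left)
  qed (use that p1 in \<open>simp add: power_0_left\<close>)
  consider "j < p - 1" | "j = p - 1" | "j > p - 1" by linarith
  then show ?thesis
  proof cases
    case 1
    then show ?thesis using prime_dvd_sum_powers[OF assms(1)] by (simp add: cong_0_iff)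
  next
    case 2
    have "(\<Sum>x<p. int x ^ j) = (\<Sum>x\<in>{1..<p}. int x ^ j)"
      using p1 2 by (intro sum.mono_neutral_right) (auto simp: not_less_eq_eq)
    also have "[\<dots> = (\<Sum>x\<in>{1..<p}. 1)] (mod int p)"
      unfolding 2 by (intro cong_sum fermat) auto
    also have "(\<Sum>x\<in>{1..<p}. 1) = int p - 1" using p1 by (simp add: of_nat_diff)
    also have "[int p - 1 = -1] (mod int p)" by (simp add: cong_iff_dvd_diff)
    finally show ?thesis using 2 by simp
  next
    case 3
    define i where "i = j - (p - 1)"
    have i: "j = p - 1 + i" "0 < i" "i < p - 1" using 3 assms(2) by (auto simp: i_def)
    have "[(\<Sum>x<p. int x ^ j) = (\<Sum>x<p. int x ^ i)] (mod int p)"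
      unfolding i(1) using i(2) by (intro cong_sum shift) auto
    also have "[(\<Sum>x<p. int x ^ i) = 0] (mod int p)"
      using prime_dvd_sum_powers[OF assms(1) i(3)] by (simp add: cong_0_iff)
    finally show ?thesis using 3 by simp
  qed
qed

section \<open>Power sum of the Legendre cubic\<close>

lemma binomial_power_diff:
  "(x - c :: int) ^ n = (\<Sum>i\<le>n. (int (n choose i) * (- c) ^ (n - i)) * x ^ i)"
  using binomial_ring[of x "- c" n] by (simp add: mult.assoc mult.commute mult.left_commute)

text \<open>The n-th power of the cubic has only monomials with exponents from n to 3n. Summation
  over the residues kills all of them except exponent 2n = p - 1, which contributes minus its
  coefficient.\<close>

lemma sum_legendre_form_power_cong:
  fixes p n :: nat and s :: int
  assumes "prime p" and p: "p = 2 * n + 1"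
  shows "[(\<Sum>x<p. (int x * (int x - 1) * (int x - s)) ^ n)
     = - ((-1) ^ n * (\<Sum>k\<le>n. int (n choose k) ^ 2 * s ^ k))] (mod int p)"
proof -
  \<comment> \<open>\<open>c r\<close> is the coefficient of \<open>x ^ r\<close> in
    \<open>(x - 1) ^ n * (x - s) ^ n\<close>; the remaining factor \<open>x ^ n\<close> shifts it to
    exponent \<open>n + r\<close>.\<close>
  define c where "c r = (\<Sum>k\<le>r. (int (n choose k) * (- 1) ^ (n - k)) *
      (int (n choose (r - k)) * (- s) ^ (n - (r - k))))" for r
  have n0: "n > 0" using assms prime_gt_1_nat[of p] by (cases n) auto
  have expand: "(x * (x - 1) * (x - s)) ^ n = (\<Sum>r\<le>n+n. c r * x ^ (n + r))" for x
  proof -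
    have "(x - 1) ^ n * (x - s) ^ n = (\<Sum>r\<le>n+n. c r * x ^ r)"
      unfolding binomial_power_diff c_def by (rule polynomial_product) (simp_all add: binomial_eq_0)
    then have "(x * (x - 1) * (x - s)) ^ n = x ^ n * (\<Sum>r\<le>n+n. c r * x ^ r)"
      by (simp add: power_mult_distrib)
    then show ?thesis by (simp add: sum_distrib_left power_add mult_ac)
  qed
  \<comment> \<open>At \<open>r = n\<close> the symmetry binom(n,n-k) = binom(n,k) turns the
    convolution into a sum of squares.\<close>
  have cn: "c n = (-1) ^ n * (\<Sum>k\<le>n. int (n choose k) ^ 2 * s ^ k)"
    unfolding c_def sum_distrib_left
  proof (rule sum.cong)
    fix k assume "k \<in> {..n}"
    then have k: "k \<le> n" by simp
    have "(-1) ^ (n - k) * (- s) ^ k = (-1) ^ (n - k + k) * s ^ k"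
      by (simp add: power_add power_minus[of s])
    then show "int (n choose k) * (- 1) ^ (n - k) * (int (n choose (n - k)) * (- s) ^ (n - (n - k)))
        = (- 1) ^ n * ((int (n choose k))\<^sup>2 * s ^ k)"
      using k binomial_symmetric[OF k] by (simp add: power2_eq_square mult_ac)
  qed simp
  have "(\<Sum>x<p. (int x * (int x - 1) * (int x - s)) ^ n)
      = (\<Sum>r\<le>n+n. c r * (\<Sum>x<p. int x ^ (n + r)))"
    by (simp only: expand sum.swap[of _ "{..<p}"] sum_distrib_left)
  also have "[\<dots> = (\<Sum>r\<le>n+n. c r * (if r = n then -1 else 0))] (mod int p)"
  proof (intro cong_sum cong_mult cong_refl)
    fix r assume "r \<in> {..n+n}"
    \<comment> \<open>The exponent is at most 3n, strictly below 4n because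
      \<open>n > 0\<close>.\<close>
    then have "n + r < 2 * (p - 1)" using n0 p by simp
    moreover have "n + r = p - 1 \<longleftrightarrow> r = n" using p by auto
    ultimately show "[(\<Sum>x<p. int x ^ (n + r)) = (if r = n then -1 else 0)] (mod int p)"
      using sum_powers_cong[OF assms(1), of "n + r"] by simp
  qed
  also have "(\<Sum>r\<le>n+n. c r * (if r = n then -1 else 0)) = - c n"
    by (simp add: if_distrib cong: if_cong)
  finally show ?thesis by (simp only: cn)
qed

section \<open>The generating sum of \<open>G_num\<close>\<close>

lemma G_sum_cong:
  fixes p n :: nat and u :: int
  assumes "prime p" and p: "p = 2 * n + 1"
  shows "[(\<Sum>N=0..p-1. int (G_num N) * u ^ N)
     = (\<Sum>k\<le>n. int (n choose k) ^ 2 * (16 * u) ^ k) * (1 - 16 * u) ^ n] (mod int p)"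
proof -
  \<comment> \<open>\<open>a k\<close> and \<open>b j\<close> are the residues of binom(2k,k)^2 and
    binom(2j,j) 4^j for indices below \<open>p\<close>.\<close>
  define a where "a k = int (n choose k) ^ 2 * 16 ^ k" for k
  define b where "b j = int (n choose j) * (-16) ^ j" for j
  have G: "[int (G_num N) = (\<Sum>k\<le>N. a k * b (N - k))] (mod int p)" if "N < p" for N
  proof -
    have G_num: "int (G_num N) = (\<Sum>k\<le>N. int ((2*k) choose k) ^ 2
        * (int ((2 * (N - k)) choose (N - k)) * 4 ^ (N - k)))"
      by (simp add: G_num_def atMost_atLeast0 diff_mult_distrib2 mult.assoc)
    have cong: "[int (G_num N) = (\<Sum>k\<le>N. ((-4) ^ k * int (n choose k)) ^ 2
        * ((-4) ^ (N - k) * int (n choose (N - k)) * 4 ^ (N - k)))] (mod int p)"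
      unfolding G_num using that
      by (intro cong_sum cong_mult[OF cong_pow cong_mult[OF _ cong_refl]] central_binomial_cong[OF assms]) auto
    have "(\<Sum>k\<le>N. ((-4) ^ k * int (n choose k)) ^ 2
        * ((-4) ^ (N - k) * int (n choose (N - k)) * 4 ^ (N - k))) = (\<Sum>k\<le>N. a k * b (N - k))"
    proof (rule sum.cong)
      fix k
      have "((-4) ^ k) ^ 2 = (16::int) ^ k" unfolding power2_eq_square power_mult_distrib[symmetric] by simp
      moreover have "(-4) ^ (N - k) * 4 ^ (N - k) = (-16::int) ^ (N - k)"
        unfolding power_mult_distrib[symmetric] by simp
      ultimately show "((-4) ^ k * int (n choose k)) ^ 2
        * ((-4) ^ (N - k) * int (n choose (N - k)) * 4 ^ (N - k)) = a k * b (N - k)"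
        by (simp add: a_def b_def power_mult_distrib mult_ac)
    qed simp
    with cong show ?thesis by simp
  qed
  have "[(\<Sum>N=0..p-1. int (G_num N) * u ^ N) = (\<Sum>N=0..p-1. (\<Sum>k\<le>N. a k * b (N - k)) * u ^ N)] (mod int p)"
    using p by (intro cong_sum cong_mult cong_refl G) auto
  \<comment> \<open>Both coefficient sequences vanish beyond \<open>n\<close>, so the cutoff
    \<open>p - 1 = n + n\<close> captures the whole product of the two polynomials.\<close>
  also have "(\<Sum>N=0..p-1. (\<Sum>k\<le>N. a k * b (N - k)) * u ^ N)
      = (\<Sum>i\<le>n. a i * u ^ i) * (\<Sum>j\<le>n. b j * u ^ j)"
    using polynomial_product[of n a n b u] p
    by (simp add: a_def b_def binomial_eq_0 atMost_atLeast0 mult_2)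
  also have "(\<Sum>j\<le>n. b j * u ^ j) = (1 - 16 * u) ^ n"
  proof -
    have "(1 - 16 * u) ^ n = ((-16) * u + 1) ^ n" by simp
    then show ?thesis
      by (simp only: binomial_ring b_def power_mult_distrib power_one mult_1_right mult.assoc)
  qed
  also have "(\<Sum>i\<le>n. a i * u ^ i) = (\<Sum>k\<le>n. int (n choose k) ^ 2 * (16 * u) ^ k)"
    unfolding a_def power_mult_distrib by (simp only: mult_ac)
  finally show ?thesis .
qed

section \<open>Affine change of variable and the given cubic\<close>

text \<open>An affine map with invertible slope permutes the residue classes, and \<open>f\<close>
  depends modulo \<open>p\<close> only on the class of its argument.\<close>

lemma sum_affine_cong:
  fixes p :: nat and f :: "int \<Rightarrow> int" and c d :: int
  assumes "coprime c (int p)" and "p > 0"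
    and f: "\<And>x y. [x = y] (mod int p) \<Longrightarrow> [f x = f y] (mod int p)"
  shows "[(\<Sum>x<p. f (int x)) = (\<Sum>x<p. f (c * int x + d))] (mod int p)"
proof -
  let ?h = "\<lambda>x. nat ((c * int x + d) mod int p)"
  have h: "int (?h x) = (c * int x + d) mod int p" for x using assms(2) by simp
  have inj: "inj_on ?h {..<p}"
  proof (rule inj_onI)
    fix x y assume xy: "x \<in> {..<p}" "y \<in> {..<p}" "?h x = ?h y"
    then have "[c * int x + d = c * int y + d] (mod int p)" using h by (metis cong_def)
    then have "[int x = int y] (mod int p)"
      using assms(1) by (simp add: cong_add_rcancel cong_mult_lcancel)
    then show "x = y" using xy by (simp add: cong_def)
  qed
  moreover have "?h ` {..<p} \<subseteq> {..<p}" using assms(2) by (auto simp: nat_less_iff)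
  ultimately have bij: "bij_betw ?h {..<p} {..<p}"
    by (simp add: bij_betw_def endo_inj_surj)
  have "(\<Sum>x<p. f (int x)) = (\<Sum>x<p. f (int (?h x)))"
    using sum.reindex_bij_betw[OF bij, of "\<lambda>x. f (int x)"] by simp
  also have "[\<dots> = (\<Sum>x<p. f (c * int x + d))] (mod int p)"
    by (intro cong_sum f) (simp add: h)
  finally show ?thesis .
qed

lemma coprime_6_prime:
  fixes p :: nat
  assumes "prime p" "odd p" "p \<noteq> 3"
  shows "coprime 6 (int p)"
proof -
  have "\<not> p dvd 2" "\<not> p dvd 3"
    using assms primes_dvd_imp_eq[of p 2] primes_dvd_imp_eq[of p 3] by auto
  then have "\<not> p dvd 2 * 3" using assms(1) prime_dvd_mult_iff by blast
  then have "coprime p 6" using assms(1) prime_imp_coprime by auto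
  then show ?thesis by (metis coprime_commute coprime_int_iff of_nat_numeral)
qed

lemma cubic_sum_power_cong:
  fixes p n :: nat and s t :: int
  assumes "prime p" and p: "p = 2 * n + 1" and "p \<noteq> 3" and t: "t = 1 - 2 * s"
  shows "[(\<Sum>x<p. (int x ^ 3 - 3 * (t\<^sup>2 + 3) * int x + 2 * t * (t\<^sup>2 - 9)) ^ n)
     = - ((-216) ^ n * (\<Sum>k\<le>n. int (n choose k) ^ 2 * s ^ k))] (mod int p)"
proof -
  define f where "f x = (x ^ 3 - 3 * (t\<^sup>2 + 3) * x + 2 * t * (t\<^sup>2 - 9)) ^ n" for x
  have cop: "coprime 6 (int p)"
    using p by (intro coprime_6_prime assms) simp
  \<comment> \<open>The affine map is the one taking the roots 0, 1, \<open>s\<close> to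
    \<open>t - 3\<close>, \<open>t + 3\<close>, \<open>- 2 * t\<close>; the slope 6 is the distance
    between the first two images.\<close>
  have shift: "f (6 * x + (-2 - 2 * s)) = 216 ^ n * (x * (x - 1) * (x - s)) ^ n" for x
    unfolding f_def t power_mult_distrib[symmetric]
    by (rule arg_cong[where f = "\<lambda>y. y ^ n"]) (simp add: algebra_simps power2_eq_square power3_eq_cube)
  have "[(\<Sum>x<p. f (int x)) = (\<Sum>x<p. f (6 * int x + (-2 - 2 * s)))] (mod int p)"
  proof (rule sum_affine_cong[OF cop])
    fix x y :: int
    assume "[x = y] (mod int p)"
    then show "[f x = f y] (mod int p)"
      unfolding f_def by (intro cong_pow cong_add cong_diff cong_mult cong_refl)
  qed (use p in simp)
  also have "(\<Sum>x<p. f (6 * int x + (-2 - 2 * s))) = 216 ^ n * (\<Sum>x<p. (int x * (int x - 1) * (int x - s)) ^ n)"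
    by (simp only: shift sum_distrib_left)
  also have "[\<dots> = 216 ^ n * - ((-1) ^ n * (\<Sum>k\<le>n. int (n choose k) ^ 2 * s ^ k))] (mod int p)"
    by (intro cong_mult cong_refl sum_legendre_form_power_cong assms)
  also have "216 ^ n * - ((-1) ^ n * (\<Sum>k\<le>n. int (n choose k) ^ 2 * s ^ k))
      = - ((-216) ^ n * (\<Sum>k\<le>n. int (n choose k) ^ 2 * s ^ k))"
    by (simp add: power_minus[of 216])
  finally show ?thesis unfolding f_def .
qed

section \<open>Powers of squares and comparison of the two sums\<close>

lemma fermat_theorem_int:
  fixes p :: nat and a :: int
  assumes "prime p" "\<not> int p dvd a"
  shows "[a ^ (p - 1) = 1] (mod int p)"
proof -
  have p: "int p > 0" using assms(1) prime_gt_0_nat by simp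
  define b where "b = nat (a mod int p)"
  have b: "int b = a mod int p" using p by (simp add: b_def)
  then have "\<not> p dvd b"
    using assms(2) by (metis dvd_mod_iff dvd_refl int_dvd_int_iff)
  then have "[int b ^ (p - 1) = 1] (mod int p)"
    using fermat_theorem[OF assms(1)] by (metis cong_int_iff of_nat_1 of_nat_power)
  then show ?thesis by (simp add: b cong_def power_mod)
qed

lemma square_power_cong_1:
  fixes p n :: nat and a :: int
  assumes "prime p" "p = 2 * n + 1" "\<not> int p dvd a"
  shows "[(a * a) ^ n = 1] (mod int p)"
  using fermat_theorem_int[OF assms(1,3)] assms(2) by (simp add: power_mult power2_eq_square)

text \<open>The twist \<open>-3 * (1 + t) = -6 * (1 - s)\<close> is what compensates the factor -216
  from the change of variable: their product is \<open>1 - s\<close> times the square of 36, and the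
  n-th power of that square is 1 for \<open>p > 3\<close>. For \<open>p = 3\<close> both sides
  vanish.\<close>

lemma hasse_sum_cong_cubic_sum:
  fixes p n :: nat and s t :: int
  assumes "prime p" and p: "p = 2 * n + 1" and t: "t = 1 - 2 * s" and s: "\<not> int p dvd s"
  shows "[(1 - s) ^ n * (\<Sum>k\<le>n. int (n choose k) ^ 2 * s ^ k)
     = - ((-3 * (1 + t)) ^ n *
        (\<Sum>x<p. (int x ^ 3 - 3 * (t\<^sup>2 + 3) * int x + 2 * t * (t\<^sup>2 - 9)) ^ n))] (mod int p)"
    (is "[_ * ?H = - (_ * ?S)] (mod _)")
proof (cases "p = 3")
  case True
  then have n: "n = 1" using p by simp
  have "[(s * s) ^ n = 1] (mod int p)" by (rule square_power_cong_1[OF assms(1,2) s])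
  then have "3 dvd s * s - 1" using True n by (simp add: cong_iff_dvd_diff)
  \<comment> \<open>With \<open>n = 1\<close> the left side is \<open>(1 - s) * (1 + s)\<close>, so
    this expression is the difference of the two sides of the goal.\<close>
  then have "3 dvd - (s * s - 1) + 3 * ((1 + t) * ?S * - 1)" by (intro dvd_add) (simp_all only: dvd_minus_iff dvd_triv_left)
  moreover have "?H = 1 + s" by (simp add: n)
  ultimately show ?thesis
    using True n by (simp add: cong_iff_dvd_diff algebra_simps)
next
  case False
  have "coprime (6 * 6) (int p)"
    using coprime_6_prime[OF assms(1) _ False] p by (simp only: coprime_mult_left_iff) simp
  then have "\<not> int p dvd 36"
    using prime_gt_1_nat[OF assms(1)] coprime_common_divisor[of 36 "int p" "int p"] by auto
  then have sq: "[(36 * 36) ^ n = 1] (mod int p)" by (rule square_power_cong_1[OF assms(1,2)])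
  have "(-6 * (1 - s)) ^ n * (-216) ^ n = (36 * 36) ^ n * (1 - s) ^ n"
    unfolding power_mult_distrib[symmetric] by (simp add: algebra_simps)
  then have "(-3 * (1 + t)) ^ n * (-216) ^ n = (36 * 36) ^ n * (1 - s) ^ n"
    by (simp add: t)
  then have eq: "- ((-3 * (1 + t)) ^ n * - ((-216) ^ n * ?H)) = (36 * 36) ^ n * ((1 - s) ^ n * ?H)"
    by (simp only: mult_minus_right minus_minus mult.assoc[symmetric])
  have "[- ((-3 * (1 + t)) ^ n * ?S) = - ((-3 * (1 + t)) ^ n * - ((-216) ^ n * ?H))] (mod int p)"
    unfolding cong_minus_minus_iff
    by (intro cong_mult cong_refl cubic_sum_power_cong[OF assms(1) p False t])
  moreover have "[(36 * 36) ^ n * ((1 - s) ^ n * ?H) = 1 * ((1 - s) ^ n * ?H)] (mod int p)"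
    by (rule cong_mult[OF sq cong_refl])
  ultimately show ?thesis
    unfolding eq mult_1_left by (meson cong_sym cong_trans)
qed

section \<open>Rationals integral at \<open>p\<close> and their integer representatives\<close>

text \<open>The reduced denominator divides every other denominator, so integrality can be read off
  any fraction; closure under sums and products then follows without reducing to lowest
  terms.\<close>

lemma p_integral_iff:
  assumes "prime p"
  shows "a \<in> p_integral p \<longleftrightarrow> (\<exists>x y. a = of_int x / of_int y \<and> \<not> int p dvd y)"
proof
  assume "a \<in> p_integral p"
  then show "\<exists>x y. a = of_int x / of_int y \<and> \<not> int p dvd y"
    unfolding p_integral_def using quotient_of_div[of a "fst (quotient_of a)" "snd (quotient_of a)"] by auto
next
  assume "\<exists>x y. a = of_int x / of_int y \<and> \<not> int p dvd y"
  then obtain x y where a: "a = of_int x / of_int y" and y: "\<not> int p dvd y" by blast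
  obtain c d where q: "quotient_of a = (c, d)" by fastforce
  have "d > 0" "coprime c d" "a = of_int c / of_int d"
    using quotient_of_denom_pos[OF q] quotient_of_coprime[OF q] quotient_of_div[OF q] by auto
  moreover have "y \<noteq> 0" using y by auto
  ultimately have "rat_of_int (x * d) = of_int (c * y)" using a by (simp add: field_simps)
  then have "d dvd c * y" by (metis dvd_triv_right of_int_eq_iff)
  then have "d dvd y" using \<open>coprime c d\<close> by (simp add: coprime_commute coprime_dvd_mult_right_iff)
  then show "a \<in> p_integral p" using y q dvd_trans unfolding p_integral_def by auto
qed

context
  fixes p :: nat
  assumes prime: "prime p"
begin

lemma p_integral_of_int [simp]: "of_int k \<in> p_integral p"
  using prime prime_gt_1_nat[OF prime] by (auto simp: p_integral_def)

lemma p_integral_add: "a \<in> p_integral p \<Longrightarrow> b \<in> p_integral p \<Longrightarrow> a + b \<in> p_integral p"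
  and p_integral_mult: "a \<in> p_integral p \<Longrightarrow> b \<in> p_integral p \<Longrightarrow> a * b \<in> p_integral p"
proof -
  assume "a \<in> p_integral p" "b \<in> p_integral p"
  then obtain x y z w where a: "a = of_int x / of_int y" "\<not> int p dvd y"
    and b: "b = of_int z / of_int w" "\<not> int p dvd w" using p_integral_iff[OF prime] by metis
  have yw: "\<not> int p dvd y * w" using a b prime by (simp add: prime_dvd_mult_iff)
  have "y \<noteq> 0" "w \<noteq> 0" using a b by auto
  then have "a + b = of_int (x * w + z * y) / of_int (y * w)" "a * b = of_int (x * z) / of_int (y * w)"
    by (simp_all add: a(1) b(1) add_frac_eq)
  with yw show "a + b \<in> p_integral p" "a * b \<in> p_integral p"
    using p_integral_iff[OF prime] by blast+
qed

lemma p_integral_minus: "a \<in> p_integral p \<Longrightarrow> - a \<in> p_integral p"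
  using p_integral_mult[OF p_integral_of_int, of a "-1"] by simp

lemma p_congI:
  assumes "b \<in> p_integral p" "c \<in> p_integral p" "a = b + of_nat p * c"
  shows "p_cong p a b"
  using assms p_integral_add[OF assms(1) p_integral_mult[OF p_integral_of_int[of "int p"] assms(2)]]
  by (auto simp: p_cong_def)

lemma p_congE:
  assumes "p_cong p a b"
  obtains c where "b \<in> p_integral p" "c \<in> p_integral p" "a = b + of_nat p * c"
  using assms by (auto simp: p_cong_def algebra_simps)

text \<open>Denominators prime to \<open>p\<close> create no new congruences between integers: if (a
  - b) y is a multiple of \<open>p\<close> and \<open>p\<close> does not divide y, then
  \<open>p\<close> divides a - b.\<close>

lemma p_cong_of_int_iff: "p_cong p (of_int a) (of_int b) \<longleftrightarrow> [a = b] (mod int p)"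
proof
  assume "p_cong p (of_int a) (of_int b)"
  then obtain c where c: "c \<in> p_integral p" "rat_of_int a = of_int b + of_nat p * c" by (rule p_congE)
  then obtain x y where xy: "c = of_int x / of_int y" "\<not> int p dvd y"
    using p_integral_iff[OF prime] by auto
  then have "y \<noteq> 0" by auto
  then have "rat_of_int ((a - b) * y) = of_int (int p * x)" using c xy by (simp add: field_simps)
  then have "int p dvd (a - b) * y" by (metis dvd_triv_left of_int_eq_iff)
  then show "[a = b] (mod int p)" using xy prime by (simp add: prime_dvd_mult_iff cong_iff_dvd_diff)
next
  assume "[a = b] (mod int p)"
  then obtain k where "a = b + int p * k" by (metis cong_iff_lin cong_sym)
  then show "p_cong p (of_int a) (of_int b)" by (intro p_congI[of _ "of_int k"]) auto
qed

lemma p_cong_sym: "p_cong p a b \<Longrightarrow> p_cong p b a"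
proof -
  assume ab: "p_cong p a b"
  then obtain c where "c \<in> p_integral p" "a = b + of_nat p * c" by (rule p_congE)
  then show ?thesis using ab by (intro p_congI[of _ "- c"]) (auto simp: p_cong_def p_integral_minus)
qed

lemma p_cong_trans: "p_cong p a b \<Longrightarrow> p_cong p b c \<Longrightarrow> p_cong p a c"
proof -
  assume "p_cong p a b" "p_cong p b c"
  then obtain d e where "d \<in> p_integral p" "a = b + of_nat p * d"
    and "c \<in> p_integral p" "e \<in> p_integral p" "b = c + of_nat p * e" by (metis p_congE)
  then show ?thesis by (intro p_congI[of _ "d + e"]) (auto simp: p_integral_add algebra_simps)
qed

lemma p_cong_add: "p_cong p a b \<Longrightarrow> p_cong p c d \<Longrightarrow> p_cong p (a + c) (b + d)"
  and p_cong_mult: "p_cong p a b \<Longrightarrow> p_cong p c d \<Longrightarrow> p_cong p (a * c) (b * d)"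
proof -
  assume "p_cong p a b" "p_cong p c d"
  then obtain e f where "b \<in> p_integral p" "e \<in> p_integral p" "a = b + of_nat p * e"
    and "d \<in> p_integral p" "f \<in> p_integral p" "c = d + of_nat p * f" by (metis p_congE)
  then show "p_cong p (a + c) (b + d)" "p_cong p (a * c) (b * d)"
    using p_integral_of_int[of "int p"]
    \<comment> \<open>The quotient witnesses come from expanding (b + p e) + (d + p f) and (b + p
      e)(d + p f).\<close>
    by (auto intro!: p_congI[of "b + d" "e + f"] p_congI[of "b * d" "b * f + e * d + of_nat p * e * f"]
        p_integral_add p_integral_mult simp: algebra_simps)
qed

text \<open>Here \<open>p_cong p a (of_int x)\<close> is read as "\<open>x\<close> is an integer
  representative of \<open>a\<close>". These rules follow the syntax of \<open>a\<close>, so that a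
  representative of a whole expression is assembled from those of its atoms.\<close>

lemma of_int_p_cong_add:
    "p_cong p a (of_int x) \<Longrightarrow> p_cong p b (of_int y) \<Longrightarrow> p_cong p (a + b) (of_int (x + y))"
  and of_int_p_cong_mult:
    "p_cong p a (of_int x) \<Longrightarrow> p_cong p b (of_int y) \<Longrightarrow> p_cong p (a * b) (of_int (x * y))"
  using p_cong_add p_cong_mult by fastforce+

lemma of_int_p_cong_of_int: "[k = x] (mod int p) \<Longrightarrow> p_cong p (of_int k) (of_int x)"
  by (simp add: p_cong_of_int_iff)

lemma of_int_p_cong_const:
  "p_cong p (of_int k) (of_int k)" "p_cong p (of_nat i) (of_int (int i))"
  "p_cong p (numeral w) (of_int (numeral w))" "p_cong p 1 (of_int 1)"
  using p_cong_of_int_iff[of k k] p_cong_of_int_iff[of "int i" "int i"]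
    p_cong_of_int_iff[of "numeral w" "numeral w"] p_cong_of_int_iff[of 1 1] by simp_all

lemma of_int_p_cong_minus: "p_cong p a (of_int x) \<Longrightarrow> p_cong p (- a) (of_int (- x))"
  using of_int_p_cong_mult[OF of_int_p_cong_const(1)[of "-1"], of a x] by simp

lemma of_int_p_cong_diff:
  "p_cong p a (of_int x) \<Longrightarrow> p_cong p b (of_int y) \<Longrightarrow> p_cong p (a - b) (of_int (x - y))"
  using of_int_p_cong_add[OF _ of_int_p_cong_minus, of a x b y] by simp

lemma of_int_p_cong_power: "p_cong p a (of_int x) \<Longrightarrow> p_cong p (a ^ n) (of_int (x ^ n))"
proof (induction n)
  case 0
  then show ?case using of_int_p_cong_const(4) by simp
next
  case (Suc n)
  then show ?case unfolding power_Suc by (intro of_int_p_cong_mult)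
qed

lemma of_int_p_cong_sum:
  "(\<And>i. i \<in> A \<Longrightarrow> p_cong p (f i) (of_int (g i))) \<Longrightarrow> p_cong p (sum f A) (of_int (sum g A))"
proof (induction A rule: infinite_finite_induct)
  case (insert i A)
  then show ?case unfolding sum.insert[OF insert.hyps] by (intro of_int_p_cong_add) auto
qed (use of_int_p_cong_const(1)[of 0] in simp_all)

lemmas of_int_p_cong_intros = of_int_p_cong_const of_int_p_cong_add of_int_p_cong_mult
  of_int_p_cong_minus of_int_p_cong_diff of_int_p_cong_power of_int_p_cong_sum

lemma of_int_p_cong_imp_p_cong:
  "p_cong p a (of_int x) \<Longrightarrow> p_cong p b (of_int y) \<Longrightarrow> [x = y] (mod int p) \<Longrightarrow> p_cong p a b"
  by (meson p_cong_of_int_iff p_cong_sym p_cong_trans)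

lemma not_dvd_imp_inverse:
  assumes "\<not> int p dvd y"
  obtains z where "[y * z = 1] (mod int p)"
proof -
  have "coprime y (int p)"
    using assms prime prime_imp_coprime[of "int p" y] by (simp add: coprime_commute)
  then show ?thesis using cong_solve_coprime_int that by blast
qed

text \<open>Since \<open>m\<close> is not 0 modulo \<open>p\<close>, its numerator is invertible as
  well as its denominator; inverses of both give representatives of \<open>m\<close> and of
  \<open>1 / m\<close>.\<close>

lemma p_integral_unit_residue:
  assumes "m \<in> p_integral p" "\<not> p_cong p m 0"
  obtains x y where "p_cong p m (of_int x)" "p_cong p (1 / m) (of_int y)" "[x * y = 1] (mod int p)"
proof -
  have frac: "p_cong p (of_int a / of_int b) (of_int (a * z))"
    if b: "\<not> int p dvd b" and z: "[b * z = 1] (mod int p)" for a b z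
  proof -
    obtain k where "b * z = 1 + int p * k" using z by (metis cong_iff_lin cong_sym)
    then have k: "rat_of_int (b * z) = of_int (1 + int p * k)" by simp
    have "b \<noteq> 0" using b by auto
    \<comment> \<open>From \<open>b * z = 1 + p * k\<close> the error a/b - a z equals -p a k / b,
      which gives the witness.\<close>
    then have "rat_of_int a / of_int b = of_int (a * z) + of_nat p * (of_int (- (a * k)) / of_int b)"
      using k by (simp add: field_simps)
    moreover have "of_int (- (a * k)) / of_int b \<in> p_integral p"
      using b p_integral_iff[OF prime] by blast
    ultimately show ?thesis by (intro p_congI[OF p_integral_of_int])
  qed
  obtain a b where m: "m = of_int a / of_int b" "\<not> int p dvd b"
    using assms(1) p_integral_iff[OF prime] by blast
  obtain b' where b': "[b * b' = 1] (mod int p)" using not_dvd_imp_inverse m by blast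
  have ma: "p_cong p m (of_int (a * b'))" using frac[OF m(2) b'] m by simp
  have "\<not> int p dvd a"
  proof
    assume "int p dvd a"
    then have "[a * b' = 0] (mod int p)" by (simp add: cong_0_iff)
    then show False
      using ma assms(2) of_int_p_cong_of_int[of "a * b'" 0] p_cong_trans by fastforce
  qed
  moreover obtain a' where a': "[a * a' = 1] (mod int p)" using not_dvd_imp_inverse calculation by blast
  ultimately have "p_cong p (1 / m) (of_int (b * a'))" using frac[OF _ a', of b] m by simp
  moreover have "[a * b' * (b * a') = 1] (mod int p)"
    using cong_mult[OF a' b'] by (simp add: mult_ac)
  ultimately show ?thesis using that ma by blast
qed

text \<open>The definite description in \<open>p_residue\<close> picks out
  \<open>x mod int p\<close>, and Euler's criterion applies to it, including the residue 0. Any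
  representative may then replace it in the power.\<close>

lemma p_legendre_cong_power:
  assumes "odd p" "p_cong p a (of_int x)"
  shows "[p_legendre a p = x ^ ((p - 1) div 2)] (mod int p)"
proof -
  have p2: "2 < p" using assms(1) prime prime_ge_2_nat[of p] by (cases "p = 2") auto
  have "p_residue p a = x mod int p"
    unfolding p_residue_def
  proof (rule the_equality)
    show "0 \<le> x mod int p \<and> x mod int p < int p \<and> p_cong p a (of_int (x mod int p))"
      using p2 p_cong_trans[OF assms(2) of_int_p_cong_of_int[of x "x mod int p"]] by simp
    fix r assume r: "0 \<le> r \<and> r < int p \<and> p_cong p a (of_int r)"
    then have "p_cong p (of_int r) (of_int x)" using assms(2) p_cong_sym p_cong_trans by blast
    then have "[r = x] (mod int p)" by (simp only: p_cong_of_int_iff)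
    then show "r = x mod int p" using r by (simp add: cong_def)
  qed
  then have "[p_legendre a p = (x mod int p) ^ ((p - 1) div 2)] (mod int p)"
    unfolding p_legendre_def using euler_criterion[OF prime p2] by simp
  then show ?thesis by (simp add: cong_def power_mod)
qed

end

section \<open>Translation into integer congruences and conclusion\<close>

theorem theorem2p7:
  fixes p :: nat and m t :: rat
  assumes "prime p" and "odd p"
    and "m \<in> p_integral p" and "\<not> p_cong p m 0"
    and "t = 1 - 32 / m"
  shows
    "p_cong p
       (\<Sum>n=0..p-1. of_nat (G_num n) / m^n)
       (of_int (p_legendre (m * (m - 16)) p)
          * (\<Sum>k=0..(p-1) div 2. of_nat ((2*k choose k)^2) / m^k))
     \<and>
     p_cong p
       (of_int (p_legendre (m * (m - 16)) p)
          * (\<Sum>k=0..(p-1) div 2. of_nat ((2*k choose k)^2) / m^k))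
       (- of_int (p_legendre (-3 * (1 + t)) p)
          * (\<Sum>x=0..p-1. of_int (p_legendre
               (of_nat x ^ 3 - 3 * (t^2 + 3) * of_nat x + 2 * t * (t^2 - 9)) p)))"
proof -
  note intros = of_int_p_cong_intros[OF \<open>prime p\<close>]
  note legendre = p_legendre_cong_power[OF \<open>prime p\<close> \<open>odd p\<close>]
  obtain n where p: "p = 2 * n + 1" using \<open>odd p\<close> by (rule oddE)
  then have n: "(p - 1) div 2 = n" by simp
  obtain M u where M: "p_cong p m (of_int M)" and u: "p_cong p (1 / m) (of_int u)"
    and Mu: "[M * u = 1] (mod int p)"
    using p_integral_unit_residue[OF assms(1,3,4)] .
  \<comment> \<open>\<open>s\<close> and \<open>T\<close> are integer representatives of 16/m and of
    \<open>t\<close>.\<close>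
  define s where "s = 16 * u"
  define T where "T = 1 - 2 * s"
  define H where "H = (\<Sum>k\<le>n. int (n choose k) ^ 2 * s ^ k)"
  let ?f = "\<lambda>x. int x ^ 3 - 3 * (T\<^sup>2 + 3) * int x + 2 * T * (T\<^sup>2 - 9)"
  have not_dvd: "\<not> int p dvd M" "\<not> int p dvd u"
  proof -
    have "\<not> int p dvd M * u"
      by (metis Mu assms(1) cong_0_iff cong_sym cong_trans not_prime_unit prime_nat_int_transfer)
    then show "\<not> int p dvd M" "\<not> int p dvd u" by auto
  qed
  have "\<not> p dvd 2"
    using \<open>prime p\<close> \<open>odd p\<close> primes_dvd_imp_eq[of p 2] by auto
  then have "\<not> int p dvd 2 ^ 4"
    using \<open>prime p\<close> prime_dvd_power[of "int p" 2 4] int_dvd_int_iff[of p 2] by auto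
  \<comment> \<open>That \<open>s\<close> is nonzero modulo \<open>p\<close> is what makes the left
    side vanish when \<open>p = 3\<close>.\<close>
  then have s: "\<not> int p dvd s"
    using not_dvd \<open>prime p\<close> by (simp add: s_def prime_dvd_mult_iff)
  have T: "p_cong p t (of_int T)"
  proof -
    have "t = 1 - 2 * (16 * (1 / m))" by (simp add: assms(5))
    then show ?thesis unfolding T_def s_def by (simp only:) (intro intros u)
  qed
  \<comment> \<open>In effect m (m - 16) = m^2 (1 - 16/m), and the square has n-th power 1.
    Inserting \<open>M * u\<close> for 1 makes the factor \<open>M\<close> visible over the
    integers.\<close>
  have leg_m: "[p_legendre (m * (m - 16)) p = (1 - s) ^ n] (mod int p)"
  proof -
    have "[M * (M - 16) = M * (M - 16 * 1)] (mod int p)" by simp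
    also have "[M * (M - 16 * 1) = M * (M - 16 * (M * u))] (mod int p)"
      using Mu by (intro cong_mult cong_diff cong_refl cong_sym[OF Mu])
    also have "M * (M - 16 * (M * u)) = M * M * (1 - s)" by (simp add: s_def algebra_simps)
    finally have "[(M * (M - 16)) ^ n = (M * M * (1 - s)) ^ n] (mod int p)" by (rule cong_pow)
    moreover have "[(M * M) ^ n * (1 - s) ^ n = 1 * (1 - s) ^ n] (mod int p)"
      by (intro cong_mult cong_refl square_power_cong_1[OF assms(1) p not_dvd(1)])
    moreover have "[p_legendre (m * (m - 16)) p = (M * (M - 16)) ^ n] (mod int p)"
      unfolding n[symmetric] by (intro legendre intros M)
    ultimately show ?thesis
      unfolding power_mult_distrib[of "M * M"] mult_1_left by (meson cong_trans)
  qed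
  have div_power: "a / m ^ k = a * (1 / m) ^ k" for a k by (simp add: power_one_over)
  \<comment> \<open>The next three facts give an integer representative for each of the three
    expressions of the theorem, so only congruences between integers remain.\<close>
  have 1: "p_cong p (\<Sum>n=0..p-1. of_nat (G_num n) / m^n) (of_int (\<Sum>N=0..p-1. int (G_num N) * u ^ N))"
    unfolding div_power by (intro intros u)
  have 2: "p_cong p (of_int (p_legendre (m * (m - 16)) p)
          * (\<Sum>k=0..(p-1) div 2. of_nat ((2*k choose k)^2) / m^k))
       (of_int (p_legendre (m * (m - 16)) p * (\<Sum>k=0..n. int ((2*k choose k)^2) * u ^ k)))"
    unfolding div_power n by (intro intros u)
  have 3: "p_cong p (- of_int (p_legendre (-3 * (1 + t)) p)
          * (\<Sum>x=0..p-1. of_int (p_legendre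
               (of_nat x ^ 3 - 3 * (t^2 + 3) * of_nat x + 2 * t * (t^2 - 9)) p)))
      (of_int (- ((-3 * (1 + T)) ^ n) * (\<Sum>x=0..p-1. ?f x ^ n)))"
    \<comment> \<open>Restoring \<open>(p - 1) div 2\<close> as the exponent lets Euler's criterion
      replace each Legendre symbol by a power.\<close>
    unfolding n[symmetric]
    by (intro of_int_p_cong_mult of_int_p_cong_minus of_int_p_cong_sum of_int_p_cong_of_int
        legendre intros T assms(1))
  have "[(\<Sum>k=0..n. int ((2*k choose k)^2) * u ^ k) = H] (mod int p)"
  proof -
    have "[int ((2*k choose k)^2) * u ^ k = int (n choose k) ^ 2 * s ^ k] (mod int p)" if "k \<le> n" for k
    proof -
      have "[int (2*k choose k) ^ 2 * u ^ k = ((-4) ^ k * int (n choose k)) ^ 2 * u ^ k] (mod int p)"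
        using that p by (intro cong_mult cong_pow cong_refl central_binomial_cong[OF assms(1) p]) simp
      moreover have "((-4) ^ k) ^ 2 = (16::int) ^ k"
        unfolding power2_eq_square power_mult_distrib[symmetric] by simp
      ultimately show ?thesis by (simp add: s_def power_mult_distrib mult_ac)
    qed
    then show ?thesis unfolding H_def atMost_atLeast0 by (intro cong_sum) simp
  qed
  then have middle: "[p_legendre (m * (m - 16)) p * (\<Sum>k=0..n. int ((2*k choose k)^2) * u ^ k)
      = (1 - s) ^ n * H] (mod int p)"
    by (rule cong_mult[OF leg_m])
  have "[(\<Sum>N=0..p-1. int (G_num N) * u ^ N) = (1 - s) ^ n * H] (mod int p)"
    using G_sum_cong[OF assms(1) p, of u] by (simp add: H_def s_def mult.commute)
  then have first: "[(\<Sum>N=0..p-1. int (G_num N) * u ^ N)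
      = p_legendre (m * (m - 16)) p * (\<Sum>k=0..n. int ((2*k choose k)^2) * u ^ k)] (mod int p)"
    using middle by (meson cong_sym cong_trans)
  have "{0..p-1} = {..<p}" using p by auto
  then have "[(1 - s) ^ n * H = - ((-3 * (1 + T)) ^ n) * (\<Sum>x=0..p-1. ?f x ^ n)] (mod int p)"
    using hasse_sum_cong_cubic_sum[OF assms(1) p T_def s] by (simp add: H_def)
  then have second: "[p_legendre (m * (m - 16)) p * (\<Sum>k=0..n. int ((2*k choose k)^2) * u ^ k)
      = - ((-3 * (1 + T)) ^ n) * (\<Sum>x=0..p-1. ?f x ^ n)] (mod int p)"
    using middle by (meson cong_trans)
  show ?thesis
    using of_int_p_cong_imp_p_cong[OF assms(1) 1 2 first] of_int_p_cong_imp_p_cong[OF assms(1) 2 3 second]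
    by blast
qed

end
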